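(* Let $(t_i)_{i\ge 0}$ be a sequence of real numbers with $|t_i|<1$ for all $i$ and $\sum_{i=0}^\infty t_i^2<\infty$, and let $e(w)=\lim_{n\to\infty}[w;t_0,\dots,t_n]$ $(|w|<1)$ be the corresponding analytic function. Let $r\in\mathbb C$ be a Runckel's point for $e$. Let $g_k=(1-t_{k-1})/2$, $k\ge 1$, and let $$g(z)=\frac{1}{1-}\,\frac{g_1z}{1-}\,\frac{g_2(1-g_1)z}{1-}\,\frac{g_3(1-g_2)z}{1-\cdots}$$ be the corresponding $g$-fraction. Then the continued fraction $g(z)$ converges generally at the point $$z_r=\frac{2}{1+\mathrm{Re}(r)}>1 .$$
   Context: Notation. For complex numbers $t_i$ with $|t_i|<1$ and $w\in\mathbb C$ with $|w|\le 1$, define recursively $[w;t_i]=t_i$ and $$[w;t_l,\dots,t_k]=\frac{t_l+w[w;t_{l+1},\dots,t_k]}{1+\overline{t}_l\,w[w;t_{l+1},\dots,t_k]},\quad 0\le l<k.$$ The limit $e(w)=\lim_{n\to\infty}[w;t_0,\dots,t_n]$ exists uniformly on compact subsets of the open unit disc and defines an analytic function bounded by $1$ there. Runckel's point: a point $r\in\mathbb C$ with $|r|=1$, $r\ne\pm1$, is a Runckel's point for $e$ if the limit $\lim_{n\to\infty}[r;t_0,\dots,t_n]$ exists and equals $1$. Correspondence with $g$-fractions: with $g_k=(1-t_{k-1})/2\in(0,1)$, one has $\frac{1+w}{1-w}\cdot\frac{1-we(w)}{1+we(w)}=g(z)$, where $z=4w/(1+w)^2$, equivalently $w=-1+2(1-\sqrt{1-z})/z$,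 a conformal map of $\mathbb C\setminus[1,+\infty)$ onto the open unit disc, with the square root positive for real $z<1$. General convergence: let $h_i(z;t)=\frac{a_i}{1+t}$, $i\ge 0$, be the Möbius transformations of the variable $t\in\mathbb C_\infty=\mathbb C\cup\{\infty\}$ with $a_0=1$, $a_1=-zg_1$, $a_i=-g_i(1-g_{i-1})z$ for $i\ge2$, and let $H_n(z;t)=h_0\circ h_1\circ\cdots\circ h_n(z;t)$ (composition in the variable $t$). The continued fraction $g(z)$ converges generally to a value $\alpha\in\mathbb C_\infty$ at $z$ if there exist sequences $u_n,v_n$ in $\mathbb C_\infty$ such that $$\lim_{n\to\infty}H_n(z;u_n)=\lim_{n\to\infty}H_n(z;v_n)=\alpha,\qquad \liminf_{n\to\infty}\sigma(u_n,v_n)>0,$$ where $\sigma$ is the chordal distance on $\mathbb C_\infty$. It converges generally at $z$ if it converges generally to some $\alpha\in\mathbb C_\infty$ at $z$. *)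

theory Defs
  imports "HOL-Analysis.Analysis"
begin

text \<open>The bracket \<open>[w; t\<^sub>l, \<dots>, t\<^sub>k]\<close>, with the parameters given as a list. Only nonempty lists
  are meaningful.\<close>

fun schur_bracket :: "complex \<Rightarrow> complex list \<Rightarrow> complex" where
  "schur_bracket w [] = 0"
| "schur_bracket w [x] = x"
| "schur_bracket w (x # y # ys) =
     (x + w * schur_bracket w (y # ys)) / (1 + cnj x * w * schur_bracket w (y # ys))"

definition schur_approximant :: "(nat \<Rightarrow> complex) \<Rightarrow> nat \<Rightarrow> complex \<Rightarrow> complex" where
  "schur_approximant t n w = schur_bracket w (map t [0..<Suc n])"

text \<open>Being a Runckel's point for \<open>e = lim\<^sub>n [\<cdot>; t\<^sub>0, \<dots>, t\<^sub>n]\<close> is a condition on the parameters \<open>t\<close>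
  of \<open>e\<close>: on the unit circle it is the approximants, not \<open>e\<close> itself, whose limit is taken.\<close>

definition Runckel_point :: "(nat \<Rightarrow> complex) \<Rightarrow> complex \<Rightarrow> bool" where
  "Runckel_point t r \<longleftrightarrow>
     norm r = 1 \<and> r \<noteq> 1 \<and> r \<noteq> - 1 \<and> (\<lambda>n. schur_approximant t n r) \<longlonglongrightarrow> 1"

text \<open>The Riemann sphere \<open>\<complex> \<union> {\<infinity>}\<close>, with \<open>None\<close> as the point at infinity.\<close>

type_synonym riemann_sphere = "complex option"

fun chordal_dist :: "riemann_sphere \<Rightarrow> riemann_sphere \<Rightarrow> real" where
  "chordal_dist (Some x) (Some y) =
     2 * norm (x - y) / (sqrt (1 + (norm x)\<^sup>2) * sqrt (1 + (norm y)\<^sup>2))"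
| "chordal_dist (Some x) None = 2 / sqrt (1 + (norm x)\<^sup>2)"
| "chordal_dist None (Some y) = 2 / sqrt (1 + (norm y)\<^sup>2)"
| "chordal_dist None None = 0"

definition tendsto_sphere :: "(nat \<Rightarrow> riemann_sphere) \<Rightarrow> riemann_sphere \<Rightarrow> bool" where
  "tendsto_sphere x \<alpha> \<longleftrightarrow> (\<lambda>n. chordal_dist (x n) \<alpha>) \<longlonglongrightarrow> 0"

text \<open>The map \<open>t \<mapsto> a / (1 + t)\<close> on the sphere; a Moebius transformation provided \<open>a \<noteq> 0\<close>.\<close>

fun cf_step :: "complex \<Rightarrow> riemann_sphere \<Rightarrow> riemann_sphere" where
  "cf_step a (Some t) = (if t = - 1 then None else Some (a / (1 + t)))"
| "cf_step a None = Some 0"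

primrec cf_compose :: "(nat \<Rightarrow> complex) \<Rightarrow> nat \<Rightarrow> riemann_sphere \<Rightarrow> riemann_sphere" where
  "cf_compose a 0 = cf_step (a 0)"
| "cf_compose a (Suc n) = cf_compose a n \<circ> cf_step (a (Suc n))"

text \<open>General convergence of the continued fraction \<open>a\<^sub>0 / (1 + a\<^sub>1 / (1 + a\<^sub>2 / (1 + \<dots>)))\<close>.\<close>

definition cf_converges_generally_to :: "(nat \<Rightarrow> complex) \<Rightarrow> riemann_sphere \<Rightarrow> bool" where
  "cf_converges_generally_to a \<alpha> \<longleftrightarrow>
     (\<exists>u v. tendsto_sphere (\<lambda>n. cf_compose a n (u n)) \<alpha> \<and>
            tendsto_sphere (\<lambda>n. cf_compose a n (v n)) \<alpha> \<and>
            liminf (\<lambda>n. ereal (chordal_dist (u n) (v n))) > 0)"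

definition cf_converges_generally :: "(nat \<Rightarrow> complex) \<Rightarrow> bool" where
  "cf_converges_generally a \<longleftrightarrow> (\<exists>\<alpha>. cf_converges_generally_to a \<alpha>)"

text \<open>The minus signs of the \<open>g\<close>-fraction are absorbed into the partial numerators;
  \<open>g 0\<close> is not used.\<close>

fun g_fraction :: "(nat \<Rightarrow> real) \<Rightarrow> complex \<Rightarrow> nat \<Rightarrow> complex" where
  "g_fraction g z 0 = 1"
| "g_fraction g z (Suc 0) = - z * of_real (g 1)"
| "g_fraction g z (Suc (Suc i)) =
     - of_real (g (Suc (Suc i))) * (1 - of_real (g (Suc i))) * z"

end

theory Submission
  imports Defs
begin

text \<open>
  On the circle, put \<open>X\<^sub>k = r [r; t\<^sub>k, \<dots>, t\<^sub>n]\<close> and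
  \<open>\<tau>\<^sub>k = (1 + t\<^sub>k\<^sub>-\<^sub>1) (X\<^sub>k - r) / ((1 + r) (1 - X\<^sub>k))\<close>, with \<open>t\<^sub>-\<^sub>1 = 1\<close>. The bracket recursion becomes
  \<open>\<tau>\<^sub>k = a\<^sub>k\<^sub>+\<^sub>1 / (1 + \<tau>\<^sub>k\<^sub>+\<^sub>1)\<close>, so that \<open>H\<^sub>n(\<tau>\<^sub>n) = (1 + r) (1 - X\<^sub>0) / ((1 - r) (1 + X\<^sub>0))\<close>, and this tends
  to \<open>1\<close> because \<open>X\<^sub>0 \<rightarrow> r\<close>. The coefficients at \<open>z\<^sub>r\<close> are real, so \<open>H\<^sub>n\<close> maps the conjugate of \<open>\<tau>\<^sub>n\<close> to
  a sequence with the same limit. Since \<open>t\<^sub>n \<rightarrow> 0\<close>, \<open>\<tau>\<^sub>n\<close> tends to the non-real number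
  \<open>- r / (1 + r)\<close> and hence stays away from its conjugate.
\<close>

text \<open>One level of the bracket recursion for the quantities \<open>X\<^sub>k\<close> instead
  of the brackets: \<open>X\<^sub>k\<close> is the step with parameter \<open>t\<^sub>k\<close>
  applied to \<open>X\<^sub>k\<^sub>+\<^sub>1\<close>.\<close>

definition schur_step :: "complex \<Rightarrow> complex \<Rightarrow> complex \<Rightarrow> complex" where
  "schur_step w t X = w * (t + X) / (1 + cnj t * X)"

lemma mult_schur_bracket_eq_foldr:
  "w * schur_bracket w (xs @ [x]) = foldr (schur_step w) xs (w * x)"
proof (induction xs)
  case (Cons a xs)
  obtain y ys where ys: "xs @ [x] = y # ys"
    by (cases xs) auto
  show ?case
    using Cons ys by (simp add: schur_step_def mult.assoc)
qed simp

lemma one_plus_mult_nonzero: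
  fixes X :: complex and t :: real
  assumes "\<bar>t\<bar> < 1" "norm X < 1"
  shows "1 + of_real t * X \<noteq> 0"
proof
  assume "1 + of_real t * X = 0"
  then have "norm (of_real t * X) = 1"
    by (metis add_eq_0_iff norm_minus_cancel norm_one)
  moreover have "\<bar>t\<bar> * norm X < 1"
    using assms mult_strict_mono[of "\<bar>t\<bar>" 1 "norm X" 1] by simp
  ultimately show False
    by (simp add: norm_mult)
qed

text \<open>The step is a disc automorphism followed by a rotation. Staying strictly inside the disc
  although \<open>w\<close> lies on the circle keeps \<open>1 - X\<close> and \<open>1 + X\<close>
  nonzero at every level.\<close>

lemma norm_schur_step_less_1:
  assumes "norm w = 1" "\<bar>t\<bar> < 1" "norm X < 1"
  shows "norm (schur_step w (of_real t) X) < 1"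
proof -
  have "(norm (1 + of_real t * X))\<^sup>2 - (norm (of_real t + X))\<^sup>2 = (1 - t\<^sup>2) * (1 - (norm X)\<^sup>2)"
    by (simp add: cmod_power2) (simp add: power2_eq_square algebra_simps)
  moreover have "0 < (1 - t\<^sup>2) * (1 - (norm X)\<^sup>2)"
    using assms by (simp add: abs_square_less_1)
  ultimately have "(norm (of_real t + X))\<^sup>2 < (norm (1 + of_real t * X))\<^sup>2"
    by linarith
  then have "norm (of_real t + X) < norm (1 + of_real t * X)"
    by (rule power2_less_imp_less) simp
  then show ?thesis
    using assms one_plus_mult_nonzero[of t X]
    by (simp add: schur_step_def norm_mult norm_divide)
qed

text \<open>This is the change of variables from \<open>X\<^sub>k\<close> to
  \<open>\<tau>\<^sub>k\<close>: it conjugates a Schur step into a continued fraction step. The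
  number \<open>c\<close> stands for the factor \<open>1 + t\<^sub>k\<^sub>-\<^sub>1\<close> of the
  next outer level and is left free so that it can also be 2.\<close>

lemma cf_step_schur_step:
  fixes w X :: complex and t c :: real
  assumes w: "norm w = 1" "w \<noteq> - 1" and t: "\<bar>t\<bar> < 1" and X: "norm X < 1"
  shows "cf_step (- of_real (c * (1 - t)) * w / (1 + w)\<^sup>2)
           (Some (of_real (1 + t) * (X - w) / ((1 + w) * (1 - X)))) =
         Some (of_real c * (schur_step w (of_real t) X - w) /
                 ((1 + w) * (1 - schur_step w (of_real t) X)))"
proof -
  define Y where "Y = schur_step w (of_real t) X"
  define D where "D = 1 + of_real t * X"
  have nz: "1 + w \<noteq> 0" "1 - X \<noteq> 0" "1 - Y \<noteq> 0" "D \<noteq> 0"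
    using w X norm_schur_step_less_1[OF w(1) t X] one_plus_mult_nonzero[OF t X]
    by (auto simp: Y_def D_def add_eq_0_iff)
  have YD: "Y * D = w * (of_real t + X)"
    using nz by (simp add: Y_def D_def schur_step_def)
  have YD1: "(1 - Y) * D = 1 + of_real t * X - w * (of_real t + X)"
    by (simp add: left_diff_distrib YD) (simp add: D_def)
  have "(Y - w) * D = - (of_real (1 - t) * w * (1 - X))"
    by (simp add: left_diff_distrib YD) (simp add: D_def algebra_simps)
  then have num: "Y - w = - (of_real (1 - t) * w * (1 - X)) / D"
    using nz by (intro eq_divide_imp)
  have "1 + of_real (1 + t) * (X - w) / ((1 + w) * (1 - X)) =
        ((1 + w) * (1 - X) + of_real (1 + t) * (X - w)) / ((1 + w) * (1 - X))"
    using nz by (simp add: add_divide_eq_iff)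
  \<comment> \<open>The weight \<open>1 + t\<close> is chosen for this cancellation: the terms
    \<open>X\<close> and \<open>w\<close> drop out, leaving
    \<open>1 + t * X - w * (t + X)\<close>.\<close>
  also have "(1 + w) * (1 - X) + of_real (1 + t) * (X - w) = (1 - Y) * D"
    unfolding YD1 by (simp add: algebra_simps)
  finally have den: "1 + of_real (1 + t) * (X - w) / ((1 + w) * (1 - X)) =
      (1 - Y) * D / ((1 + w) * (1 - X))" .
  have "of_real (1 + t) * (X - w) / ((1 + w) * (1 - X)) \<noteq> - 1"
    using den nz by (auto simp: add_eq_0_iff)
  moreover have "- of_real (c * (1 - t)) * w / (1 + w)\<^sup>2 / ((1 - Y) * D / ((1 + w) * (1 - X))) =
      of_real c * (Y - w) / ((1 + w) * (1 - Y))"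
  proof -
    \<comment> \<open>Here \<open>p\<close>, \<open>q\<close>, \<open>s\<close> stand for
      \<open>1 + w\<close>, \<open>1 - X\<close>, \<open>1 - Y\<close>, so that the simplifier
      treats these factors as atoms.\<close>
    have "- of_real (c * (1 - t)) * w / p\<^sup>2 / (s * D / (p * q)) =
        of_real c * (- (of_real (1 - t) * w * q) / D) / (p * s)"
      if "p \<noteq> 0" "q \<noteq> 0" "s \<noteq> 0" for p q s :: complex
      using that nz by (simp add: power2_eq_square divide_simps)
    then show ?thesis
      unfolding num using nz by blast
  qed
  ultimately show ?thesis
    using den by (simp add: Y_def)
qed

text \<open>The outermost step has partial numerator 1. Its value is the expression in the
  correspondence between \<open>e\<close> and the g-fraction, with \<open>X\<close> in place of
  \<open>w * e(w)\<close>.\<close>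

lemma cf_step_0_value:
  fixes w X :: complex
  assumes "norm w = 1" "w \<noteq> 1" "w \<noteq> - 1" "norm X < 1"
  shows "cf_step 1 (Some (2 * (X - w) / ((1 + w) * (1 - X)))) =
         Some ((1 + w) * (1 - X) / ((1 - w) * (1 + X)))"
proof -
  have nz: "1 + w \<noteq> 0" "1 - w \<noteq> 0" "1 - X \<noteq> 0" "1 + X \<noteq> 0"
    using assms by (auto simp: add_eq_0_iff)
  have "1 + 2 * (X - w) / ((1 + w) * (1 - X)) =
        ((1 + w) * (1 - X) + 2 * (X - w)) / ((1 + w) * (1 - X))"
    using nz by (simp add: add_divide_eq_iff)
  also have "(1 + w) * (1 - X) + 2 * (X - w) = (1 - w) * (1 + X)"
    by (simp add: algebra_simps)
  finally have "1 + 2 * (X - w) / ((1 + w) * (1 - X)) =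
      (1 - w) * (1 + X) / ((1 + w) * (1 - X))" .
  moreover from this have "2 * (X - w) / ((1 + w) * (1 - X)) \<noteq> - 1"
    using nz by (auto simp: add_eq_0_iff)
  ultimately show ?thesis
    by simp
qed

text \<open>The convention \<open>t\<^sub>-\<^sub>1 = 1\<close> gives the factor \<open>2\<close> at index \<open>0\<close>.\<close>

definition tail_value :: "(nat \<Rightarrow> real) \<Rightarrow> complex \<Rightarrow> nat \<Rightarrow> complex \<Rightarrow> complex" where
  "tail_value t w n X =
     of_real (case n of 0 \<Rightarrow> 2 | Suc k \<Rightarrow> 1 + t k) * (X - w) / ((1 + w) * (1 - X))"

lemma cf_compose_tail_value:
  fixes t g :: "nat \<Rightarrow> real" and w X :: complex
  assumes w: "norm w = 1" "w \<noteq> 1" "w \<noteq> - 1" and t: "\<And>i. \<bar>t i\<bar> < 1"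
    and g: "\<And>k. k \<ge> 1 \<Longrightarrow> g k = (1 - t (k - 1)) / 2"
    and X: "norm X < 1"
  defines "F \<equiv> \<lambda>n. foldr (schur_step w) (map (\<lambda>i. of_real (t i)) [0..<n])"
  shows "cf_compose (g_fraction g (4 * w / (1 + w)\<^sup>2)) n (Some (tail_value t w n X)) =
         Some ((1 + w) * (1 - F n X) / ((1 - w) * (1 + F n X))) \<and> norm (F n X) < 1"
  using X
proof (induction n arbitrary: X)
  case 0
  then show ?case
    using cf_step_0_value[OF w 0] by (simp add: tail_value_def F_def)
next
  case (Suc n)
  define Y where "Y = schur_step w (of_real (t n)) X"
  have Y: "norm Y < 1"
    using norm_schur_step_less_1[OF w(1) t Suc.prems] by (simp add: Y_def)
  \<comment> \<open>The 4 cancels the two halves in \<open>g (n + 1)\<close> and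
    \<open>1 - g n\<close>. For \<open>n = 0\<close> the second of these factors is absent, which
    leaves the 2.\<close>
  have coeff: "g_fraction g (4 * w / (1 + w)\<^sup>2) (Suc n) =
      - of_real ((case n of 0 \<Rightarrow> 2 | Suc k \<Rightarrow> 1 + t k) * (1 - t n)) * w / (1 + w)\<^sup>2"
    using w(3) by (cases n) (simp_all add: g add_eq_0_iff field_simps)
  have "cf_step (g_fraction g (4 * w / (1 + w)\<^sup>2) (Suc n)) (Some (tail_value t w (Suc n) X)) =
        Some (tail_value t w n Y)"
    unfolding coeff using cf_step_schur_step[OF w(1,3) t Suc.prems]
    by (simp add: tail_value_def Y_def)
  moreover have "F (Suc n) X = F n Y"
    by (simp add: F_def Y_def)
  ultimately show ?case
    using Suc.IH[OF Y] by simp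
qed

lemma cf_compose_cnj:
  assumes "\<And>i. a i \<in> \<real>"
  shows "cf_compose a n (map_option cnj x) = map_option cnj (cf_compose a n x)"
proof -
  have "cf_step (a i) (map_option cnj y) = map_option cnj (cf_step (a i) y)" for i y
  proof (cases y)
    case (Some s)
    have "cnj s = - 1 \<longleftrightarrow> s = - 1"
      by (simp add: complex_eq_iff)
    with Some show ?thesis
      using assms[of i] by (simp add: Reals_cnj_iff)
  qed simp
  then show ?thesis
    by (induction n arbitrary: x) simp_all
qed

lemma tendsto_chordal_dist:
  assumes "f \<longlonglongrightarrow> x" "h \<longlonglongrightarrow> y"
  shows "(\<lambda>n. chordal_dist (Some (f n)) (Some (h n))) \<longlonglongrightarrow> chordal_dist (Some x) (Some y)"
proof -
  have "sqrt (1 + (norm z)\<^sup>2) \<noteq> 0" for z :: complex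
    by (smt (verit) real_sqrt_eq_zero_cancel_iff zero_le_power2)
  then show ?thesis
    unfolding chordal_dist.simps by (intro tendsto_intros assms) simp
qed

lemma tendsto_sphere_Some:
  assumes "f \<longlonglongrightarrow> x"
  shows "tendsto_sphere (\<lambda>n. Some (f n)) (Some x)"
  using tendsto_chordal_dist[OF assms tendsto_const[of x]] by (simp add: tendsto_sphere_def)

lemma chordal_dist_Some_pos:
  assumes "x \<noteq> y"
  shows "0 < chordal_dist (Some x) (Some y)"
  using assms by (auto intro!: divide_pos_pos mult_pos_pos simp: add_pos_nonneg)

theorem theorem2p2:
  fixes t g :: "nat \<Rightarrow> real" and e :: "complex \<Rightarrow> complex" and r :: complex
  assumes "\<And>i. \<bar>t i\<bar> < 1"
    and "summable (\<lambda>i. (t i)\<^sup>2)"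
    and "\<And>w. norm w < 1 \<Longrightarrow>
           e w = lim (\<lambda>n. schur_approximant (\<lambda>i. complex_of_real (t i)) n w)"
    and "Runckel_point (\<lambda>i. complex_of_real (t i)) r"
    and "\<And>k. k \<ge> 1 \<Longrightarrow> g k = (1 - t (k - 1)) / 2"
  shows "2 / (1 + Re r) > 1 \<and>
         cf_converges_generally (g_fraction g (complex_of_real (2 / (1 + Re r))))"
proof -
  define A where "A = (\<lambda>n. schur_approximant (\<lambda>i. complex_of_real (t i)) n r)"
  have r: "norm r = 1" "r \<noteq> 1" "r \<noteq> - 1" and A: "A \<longlonglongrightarrow> 1"
    using assms(4) by (auto simp: Runckel_point_def A_def)
  have nz: "1 + r \<noteq> 0" "1 - r \<noteq> 0"
    using r by (auto simp: add_eq_0_iff)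
  have r_cnj: "r * cnj r = 1"
    using r(1) by (simp add: complex_norm_square[symmetric])
  have sq: "(Re r)\<^sup>2 + (Im r)\<^sup>2 = 1"
    using r(1) by (simp add: cmod_power2[symmetric])
  have Im: "Im r \<noteq> 0"
  proof
    assume "Im r = 0"
    with sq have "Re r = 1 \<or> Re r = - 1"
      by (simp add: power2_eq_1_iff)
    with \<open>Im r = 0\<close> r show False
      by (auto simp: complex_eq_iff)
  qed
  then have "(Im r)\<^sup>2 > 0"
    by simp
  with sq have "(Re r)\<^sup>2 < 1"
    by linarith
  then have "\<bar>Re r\<bar> < 1"
    by (simp add: abs_square_less_1)
  then have Re: "- 1 < Re r" "Re r < 1"
    by auto
  then have z_gt: "2 / (1 + Re r) > 1"
    by simp
  \<comment> \<open>Since \<open>1 / r = cnj r\<close>, dividing \<open>(1 + r)\<^sup>2\<close> by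
    \<open>r\<close> gives \<open>2 + r + cnj r\<close>, which is twice
    \<open>1 + Re r\<close>.\<close>
  have z: "complex_of_real (2 / (1 + Re r)) = 4 * r / (1 + r)\<^sup>2"
  proof -
    have "of_real (2 * (1 + Re r)) = 2 + (r + cnj r)"
      by (simp add: complex_add_cnj)
    then have "of_real (2 * (1 + Re r)) * r = 2 * r + r * r + r * cnj r"
      by (simp add: algebra_simps)
    then have square: "(1 + r)\<^sup>2 = of_real (2 * (1 + Re r)) * r"
      using r_cnj by (simp add: power2_eq_square algebra_simps)
    have "r \<noteq> 0" "complex_of_real (1 + Re r) \<noteq> 0"
      using r Re by (auto simp del: of_real_add)
    then show ?thesis
      unfolding square of_real_mult of_real_divide by (simp add: divide_simps del: of_real_add)
  qed
  define a where "a = g_fraction g (complex_of_real (2 / (1 + Re r)))"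
  have a_real: "a i \<in> \<real>" for i
    unfolding a_def by (cases "(g, complex_of_real (2 / (1 + Re r)), i)" rule: g_fraction.cases) auto
  define X where "X = (\<lambda>n. r * A n)"
  \<comment> \<open>The innermost bracket is \<open>[r; t\<^sub>n] = t\<^sub>n\<close>, so
    \<open>X\<^sub>n\<close> is \<open>r * t n\<close>, a point of the open disc.\<close>
  define u where "u = (\<lambda>n. tail_value t r n (r * of_real (t n)))"
  define v where "v = (\<lambda>n. (1 + r) * (1 - X n) / ((1 - r) * (1 + X n)))"
  have X_foldr:
    "X n = foldr (schur_step r) (map (\<lambda>i. of_real (t i)) [0..<n]) (r * of_real (t n))" for n
    by (simp add: X_def A_def schur_approximant_def mult_schur_bracket_eq_foldr)
  have Hu: "cf_compose a n (Some (u n)) = Some (v n)" for n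
  proof -
    have "norm (r * of_real (t n)) < 1"
      using r(1) assms(1) by (simp add: norm_mult)
    with cf_compose_tail_value[where t = t and g = g and n = n, OF r assms(1) assms(5)]
    show ?thesis
      unfolding a_def z u_def v_def X_foldr by blast
  qed
  then have Hu_cnj: "cf_compose a n (Some (cnj (u n))) = Some (cnj (v n))" for n
    using cf_compose_cnj[of a n "Some (u n)", OF a_real] by simp
  have X: "X \<longlonglongrightarrow> r"
    unfolding X_def using tendsto_mult_left[OF A, of r] by simp
  have "v \<longlonglongrightarrow> (1 + r) * (1 - r) / ((1 - r) * (1 + r))"
    unfolding v_def using nz by (intro tendsto_intros X) simp
  then have v: "v \<longlonglongrightarrow> 1"
    using nz by (simp add: mult.commute)
  then have v_cnj: "(\<lambda>n. cnj (v n)) \<longlonglongrightarrow> 1"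
    using tendsto_cnj[OF v] by simp
  have "(\<lambda>n. sqrt ((t n)\<^sup>2)) \<longlonglongrightarrow> sqrt 0"
    using assms(2) by (intro tendsto_intros summable_LIMSEQ_zero)
  then have t0: "t \<longlonglongrightarrow> 0"
    by (simp add: tendsto_rabs_zero_iff)
  \<comment> \<open>The shift removes the exceptional factor 2 at index 0; the remaining factors
    \<open>1 + t n\<close> tend to 1.\<close>
  have "(\<lambda>n. u (Suc n)) \<longlonglongrightarrow> of_real (1 + 0) * (r * of_real 0 - r) / ((1 + r) * (1 - r * of_real 0))"
    unfolding u_def tail_value_def nat.case using nz
    by (intro tendsto_intros t0 LIMSEQ_Suc) auto
  then have u: "u \<longlonglongrightarrow> - r / (1 + r)"
    by (simp add: filterlim_sequentially_Suc)
  \<comment> \<open>After cross-multiplication \<open>r * cnj r\<close> cancels, and equality would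
    make \<open>r\<close> real.\<close>
  have "- r / (1 + r) \<noteq> cnj (- r / (1 + r))"
  proof
    assume "- r / (1 + r) = cnj (- r / (1 + r))"
    moreover have "1 + cnj r \<noteq> 0"
      using nz by (metis complex_cnj_add complex_cnj_one complex_cnj_zero_iff)
    ultimately have "r * (1 + cnj r) = cnj r * (1 + r)"
      using nz by (simp add: frac_eq_eq)
    then have "r = cnj r"
      by (simp add: algebra_simps)
    then show False
      using Im by (simp add: complex_eq_iff)
  qed
  then have "0 < chordal_dist (Some (- r / (1 + r))) (Some (cnj (- r / (1 + r))))"
    by (rule chordal_dist_Some_pos)
  moreover have "liminf (\<lambda>n. ereal (chordal_dist (Some (u n)) (Some (cnj (u n))))) =
      ereal (chordal_dist (Some (- r / (1 + r))) (Some (cnj (- r / (1 + r)))))"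
    by (intro lim_imp_Liminf tendsto_ereal tendsto_chordal_dist u tendsto_cnj) simp
  ultimately have "0 < liminf (\<lambda>n. ereal (chordal_dist (Some (u n)) (Some (cnj (u n)))))"
    by (metis ereal_less(2))
  then have "cf_converges_generally_to a (Some 1)"
    unfolding cf_converges_generally_to_def
    by (intro exI[of _ "\<lambda>n. Some (u n)"] exI[of _ "\<lambda>n. Some (cnj (u n))"])
      (simp add: Hu Hu_cnj tendsto_sphere_Some v v_cnj)
  then show ?thesis
    using z_gt by (auto simp: cf_converges_generally_def a_def)
qed

end
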